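(* Let the diamond graph be the graph on vertices $d_1,d_2,d_3,d_4$ with edges $d_1d_2$, $d_1d_3$, $d_2d_3$, $d_2d_4$, $d_3d_4$ (i.e. $K_4$ minus the edge $d_1d_4$). Let $H$ be the $(d_2,2)$-ordering of the diamond graph. Then $R_<(H)\le 17$.
   Context: A $k$-ordering of a graph $H$ assigns distinct order-labels from $\{1,\ldots,|H|\}$ to $k$ of the vertices of $H$. For a vertex $v$ of $H$ and $1\le l\le |H|$, the $(v,l)$-ordering of $H$ is the 1-ordering in which $v$ receives order-label $l$ and no other vertex is labeled. An ordered 2-coloring on $n$ vertices is a red/blue coloring of the edges of the complete graph on vertex set $\{1,\ldots,n\}$. It contains a $k$-ordering $H$ (in a given color) if it has a subgraph isomorphic to $H$, all of whose edges have that color, such that for every $i$ the $i$-th smallest vertex of the copy corresponds to a vertex of $H$ that has order-label $i$ or no order-label. $R_<(H)$ is the least $n$ such that every ordered 2-coloring on $n$ vertices contains a monochromatic (red or blue) copy of $H$. *)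

theory Defs
  imports "HOL-Library.Ramsey"
begin

datatype color = Red | Blue

record 'a partial_ordering =
  verts :: "'a set"
  edges :: "'a set set"
  order_label :: "'a \<Rightarrow> nat option"

definition k_ordering :: "nat \<Rightarrow> 'a partial_ordering \<Rightarrow> bool" where
  "k_ordering k H \<longleftrightarrow>
     finite (verts H) \<and> edges H \<subseteq> [verts H]\<^bsup>2\<^esup> \<and>
     dom (order_label H) \<subseteq> verts H \<and> card (dom (order_label H)) = k \<and>
     ran (order_label H) \<subseteq> {1..card (verts H)} \<and>
     inj_on (order_label H) (dom (order_label H))"

definition vertex_ordering :: "'a set \<Rightarrow> 'a set set \<Rightarrow> 'a \<Rightarrow> nat \<Rightarrow> 'a partial_ordering" where
  "vertex_ordering V E v l = \<lparr>verts = V, edges = E, order_label = [v \<mapsto> l]\<rparr>"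

text \<open>
  An ordered 2-coloring on \<open>n\<close> vertices is a function \<open>c\<close> that assigns a color to every
  element of \<open>[{1..n}]\<^bsup>2\<^esup>\<close>; its values on other sets are never consulted.
  The embedding \<open>f\<close> is not required to reflect edges, so copies are subgraphs, not
  necessarily induced ones.
  The list \<open>sorted_list_of_set\<close> is indexed from 0, so its entry \<open>i - 1\<close> is the
  \<open>i\<close>-th smallest vertex of the copy.
\<close>

definition contains_in_color ::
    "nat \<Rightarrow> (nat set \<Rightarrow> color) \<Rightarrow> color \<Rightarrow> 'a partial_ordering \<Rightarrow> bool" where
  "contains_in_color n c col H \<longleftrightarrow>
     (\<exists>f. inj_on f (verts H) \<and> f ` verts H \<subseteq> {1..n} \<and>
          (\<forall>e\<in>edges H. c (f ` e) = col) \<and>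
          (\<forall>i\<in>{1..card (verts H)}. \<exists>v\<in>verts H.
             f v = sorted_list_of_set (f ` verts H) ! (i - 1) \<and>
             (order_label H v = Some i \<or> order_label H v = None)))"

definition arrows :: "nat \<Rightarrow> 'a partial_ordering \<Rightarrow> bool" where
  "arrows n H \<longleftrightarrow> (\<forall>c. \<exists>col. contains_in_color n c col H)"

definition ordered_ramsey :: "'a partial_ordering \<Rightarrow> nat" where
  "ordered_ramsey H = (LEAST n. arrows n H)"

datatype diamond_vertex = D1 | D2 | D3 | D4

definition diamond_verts :: "diamond_vertex set" where
  "diamond_verts = {D1, D2, D3, D4}"

definition diamond_edges :: "diamond_vertex set set" where
  "diamond_edges = {{D1, D2}, {D1, D3}, {D2, D3}, {D2, D4}, {D3, D4}}"

text \<open>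
  The set of \<open>n\<close> over which \<open>ordered_ramsey\<close> takes the least element is nonempty for
  every \<open>k\<close>-ordering, by Ramsey's theorem.
\<close>

lemma extend_labels:
  assumes H: "k_ordering k H"
  obtains g where "bij_betw g (verts H) {1..card (verts H)}"
    and "\<And>v i. order_label H v = Some i \<Longrightarrow> g v = i"
proof -
  define V where "V = verts H"
  define L where "L = order_label H"
  define D where "D = dom L"
  define h where "h v = the (L v)" for v
  have fV: "finite V" and DV: "D \<subseteq> V" and ran: "ran L \<subseteq> {1..card V}" and injL: "inj_on L D"
    using H by (auto simp: k_ordering_def V_def L_def D_def)
  have inj: "inj_on h D"
  proof (rule inj_onI)
    fix x y assume xy: "x \<in> D" "y \<in> D" "h x = h y"
    then have "L x = L y" unfolding D_def h_def by (metis domD option.sel)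
    then show "x = y" using injL xy by (simp add: inj_on_eq_iff)
  qed
  have hD: "h ` D \<subseteq> {1..card V}"
    using ran by (auto simp: D_def h_def ran_def)
  have "card (V - D) = card ({1..card V} - h ` D)"
    using fV DV hD inj by (simp add: card_Diff_subset finite_subset card_image)
  then obtain g' where g': "bij_betw g' (V - D) ({1..card V} - h ` D)"
    using fV finite_same_card_bij by (metis finite_Diff finite_atLeastAtMost)
  define g where "g v = (if v \<in> D then h v else g' v)" for v
  have "bij_betw g D (h ` D)"
    using inj by (simp add: bij_betw_def g_def inj_on_def)
  moreover have "bij_betw g (V - D) ({1..card V} - h ` D)"
    using g' by (rule bij_betw_cong[THEN iffD1, rotated]) (simp add: g_def)
  ultimately have "bij_betw g (D \<union> (V - D)) (h ` D \<union> ({1..card V} - h ` D))"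
    by (rule bij_betw_combine) auto
  moreover have "D \<union> (V - D) = V" "h ` D \<union> ({1..card V} - h ` D) = {1..card V}"
    using DV hD by auto
  ultimately have "bij_betw g V {1..card V}" by simp
  moreover have "g v = i" if "L v = Some i" for v i
    using that by (auto simp: g_def h_def D_def)
  ultimately show ?thesis using that by (simp add: V_def L_def)
qed

lemma ex_arrows:
  assumes H: "k_ordering k H"
  shows "\<exists>n. arrows n H"
proof -
  define V where "V = verts H"
  define m where "m = card V"
  obtain g where g: "bij_betw g V {1..m}" and gl: "\<And>v i. order_label H v = Some i \<Longrightarrow> g v = i"
    using extend_labels[OF H] unfolding V_def m_def by metis
  have EV: "edges H \<subseteq> [V]\<^bsup>2\<^esup>" using H by (simp add: k_ordering_def V_def)
  obtain r where r: "\<And>(W::nat set) E. finite W \<Longrightarrow> card W \<ge> r \<Longrightarrow>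
      \<exists>R \<subseteq> W. card R = m \<and> clique R E \<or> card R = m \<and> indep R E"
    using ramsey2[of m m] by blast
  have "\<exists>col. contains_in_color r c col H" for c
  proof -
    obtain R where RW: "R \<subseteq> {1..r}" and cR: "card R = m"
      and cl: "clique R {e. c e = Red} \<or> indep R {e. c e = Red}"
      using r[of "{1..r}" "{e. c e = Red}"] by auto
    have "\<exists>col. \<forall>x\<in>R. \<forall>y\<in>R. x \<noteq> y \<longrightarrow> c {x, y} = col"
    proof -
      have *: "x = Blue" if "x \<noteq> Red" for x :: color using that by (cases x) auto
      from cl show ?thesis
      proof
        assume "clique R {e. c e = Red}"
        then show ?thesis by (intro exI[of _ Red]) (simp add: clique_def)
      next
        assume "indep R {e. c e = Red}"
        then show ?thesis by (intro exI[of _ Blue]) (simp add: indep_def *)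
      qed
    qed
    then obtain col where col: "\<And>x y. x \<in> R \<Longrightarrow> y \<in> R \<Longrightarrow> x \<noteq> y \<Longrightarrow> c {x, y} = col"
      by blast
    have fR: "finite R" using RW finite_subset by blast
    define s where "s i = sorted_list_of_set R ! (i - 1)" for i
    have "bij_betw (\<lambda>i. i - 1) {1..m} {..<m}"
      by (rule bij_betwI[where g = Suc]) auto
    moreover have "bij_betw ((!) (sorted_list_of_set R)) {..<m} R"
      by (rule bij_betw_nth) (use fR cR in auto)
    ultimately have "bij_betw ((!) (sorted_list_of_set R) \<circ> (\<lambda>i. i - 1)) {1..m} R"
      by (rule bij_betw_trans)
    moreover have "(!) (sorted_list_of_set R) \<circ> (\<lambda>i. i - 1) = s"
      by (auto simp: s_def)
    ultimately have "bij_betw s {1..m} R" by simp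
    then have f: "bij_betw (s \<circ> g) V R" using g bij_betw_trans by blast
    have fV: "(s \<circ> g) ` V = R" using f by (simp add: bij_betw_def)
    have finj: "inj_on (s \<circ> g) V" using f by (simp add: bij_betw_def)
    have "c ((s \<circ> g) ` e) = col" if e: "e \<in> edges H" for e
    proof -
      obtain x y where xy: "e = {x, y}" "x \<in> V" "y \<in> V" "x \<noteq> y"
        using subsetD[OF EV e] by (rule nsets2_E) blast
      have "(s \<circ> g) x \<in> R" "(s \<circ> g) y \<in> R" using fV xy by blast+
      moreover have "(s \<circ> g) x \<noteq> (s \<circ> g) y"
        using finj xy by (simp only: inj_on_eq_iff not_False_eq_True)
      ultimately have "c {(s \<circ> g) x, (s \<circ> g) y} = col" by (rule col)
      then show ?thesis using xy by simp
    qed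
    moreover have "\<exists>v\<in>V. (s \<circ> g) v = sorted_list_of_set ((s \<circ> g) ` V) ! (i - 1) \<and>
        (order_label H v = Some i \<or> order_label H v = None)" if "i \<in> {1..m}" for i
    proof -
      have "i \<in> g ` V" using g that by (simp add: bij_betw_def)
      then obtain v where "v \<in> V" "g v = i" by blast
      then have "(s \<circ> g) v = sorted_list_of_set ((s \<circ> g) ` V) ! (i - 1)"
        unfolding fV by (simp add: s_def)
      moreover have "order_label H v = Some i \<or> order_label H v = None"
        using gl[of v] \<open>g v = i\<close> by (cases "order_label H v") auto
      ultimately show ?thesis using \<open>v \<in> V\<close> by blast
    qed
    ultimately show ?thesis
      unfolding contains_in_color_def using finj fV RW unfolding V_def m_def
      by (intro exI[of _ col] exI[of _ "s \<circ> g"] conjI ballI) blast+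
  qed
  then show ?thesis by (auto simp: arrows_def)
qed

lemma k_ordering_diamond: "k_ordering 1 (vertex_ordering diamond_verts diamond_edges D2 2)"
  by (auto simp: k_ordering_def vertex_ordering_def diamond_verts_def diamond_edges_def nsets_def)

end

theory Submission
  imports Defs
begin

text \<open>
  Vertex 1 has at least six neighbours \<open>R\<close> to which it is joined in one color, say red. If
  \<open>x \<in> R\<close> had two larger red neighbours \<open>y\<close>, \<open>z\<close> in \<open>R\<close>, then \<open>1 < x < y < z\<close> would carry a red
  diamond with \<open>x\<close> in second place and \<open>{1, x}\<close> as its central edge. So every vertex of \<open>R\<close> has
  at most one larger red neighbour in \<open>R\<close>. Hence the least vertex \<open>a\<close> of \<open>R\<close> has at least four
  blue neighbours in \<open>R\<close>, the least \<open>b\<close> of these has at least two larger blue neighbours among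
  them, and these two together with \<open>a\<close> and \<open>b\<close> form a blue diamond. This needs only 12 vertices.
\<close>

lemma contains_diamondI:
  assumes "1 \<le> p" "p < q" "q < r" "r < s" "s \<le> n"
    and "c {p, q} = col" "c {p, r} = col" "c {p, s} = col" "c {q, r} = col" "c {q, s} = col"
  shows "contains_in_color n c col (vertex_ordering diamond_verts diamond_edges D2 2)"
proof -
  \<comment> \<open>The pair \<open>{r, s}\<close> is the one whose color is unconstrained, so
    \<open>p\<close> and \<open>q\<close> must be the central vertices; \<open>D2\<close> goes to
    \<open>q\<close>, the second smallest.\<close>
  define f where "f v = (case v of D1 \<Rightarrow> r | D2 \<Rightarrow> q | D3 \<Rightarrow> p | D4 \<Rightarrow> s)" for v
  have f_simps: "f D1 = r" "f D2 = q" "f D3 = p" "f D4 = s"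
    by (simp_all add: f_def)
  have im: "f ` diamond_verts = {p, q, r, s}"
    by (auto simp: diamond_verts_def f_simps)
  have sorted: "sorted_list_of_set {p, q, r, s} = [p, q, r, s]"
    using sorted_list_of_set.idem_if_sorted_distinct[of "[p, q, r, s]"] assms by simp
  have "inj_on f diamond_verts"
    using assms by (auto simp: inj_on_def diamond_verts_def f_simps)
  moreover have "f ` diamond_verts \<subseteq> {1..n}"
    using assms unfolding im by auto
  moreover have "\<forall>e\<in>diamond_edges. c (f ` e) = col"
    using assms by (simp add: diamond_edges_def f_simps insert_commute)
  moreover have "\<exists>v\<in>diamond_verts. f v = sorted_list_of_set (f ` diamond_verts) ! (i - 1) \<and>
      ([D2 \<mapsto> 2] v = Some i \<or> [D2 \<mapsto> 2 :: nat] v = None)" if i: "i \<in> {1..card diamond_verts}" for i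
  proof -
    have "i \<in> {1, 2, 3, 4}"
      using i by (auto simp: diamond_verts_def)
    then show ?thesis
      unfolding im sorted by (auto simp: diamond_verts_def f_simps)
  qed
  ultimately show ?thesis
    unfolding contains_in_color_def by (intro exI[of _ f]) (simp add: vertex_ordering_def)
qed

lemma card_ge_2_obtain_less:
  fixes X :: "'a :: linorder set"
  assumes "2 \<le> card X"
  obtains x y where "x \<in> X" "y \<in> X" "x < y"
proof -
  obtain x y where "x \<in> X" "y \<in> X" "x \<noteq> y"
    using assms by (metis card_2_iff' obtain_subset_with_card_n subsetD)
  then show ?thesis
    using that by (cases x y rule: linorder_cases) auto
qed

text \<open>The two elements lost are \<open>Min X\<close> and at most one larger element satisfying
  \<open>P\<close>. Applied to \<open>R\<close> and then to \<open>B\<close>, with \<open>P\<close>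
  meaning joined to the minimum in color \<open>col\<close>.\<close>

lemma card_larger_not_neighbours:
  fixes X :: "'a :: linorder set"
  assumes X: "finite X" "X \<noteq> {}"
    and P: "\<And>y z. y \<in> X \<Longrightarrow> z \<in> X \<Longrightarrow> Min X < y \<Longrightarrow> y < z \<Longrightarrow> \<not> (P y \<and> P z)"
  shows "card X \<le> card {y \<in> X. Min X < y \<and> \<not> P y} + 2"
proof -
  let ?N = "{y \<in> X. Min X < y \<and> P y}" and ?M = "{y \<in> X. Min X < y \<and> \<not> P y}"
  have "card ?N \<le> 1"
  proof (rule ccontr)
    assume "\<not> card ?N \<le> 1"
    then obtain y z where "y \<in> ?N" "z \<in> ?N" "y < z"
      using card_ge_2_obtain_less[of ?N] by auto
    then show False using P by blast
  qed
  moreover have "X \<subseteq> {Min X} \<union> ?N \<union> ?M"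
    using X by (auto simp: order.strict_iff_order)
  then have "card X \<le> card ({Min X} \<union> ?N \<union> ?M)"
    using X by (intro card_mono) auto
  moreover have "card ({Min X} \<union> ?N \<union> ?M) \<le> 1 + card ?N + card ?M"
    using card_Un_le[of "{Min X} \<union> ?N" ?M] card_Un_le[of "{Min X}" ?N] by simp
  ultimately show ?thesis by simp
qed

lemma arrows_diamond:
  assumes "12 \<le> n"
  shows "arrows n (vertex_ordering diamond_verts diamond_edges D2 2)" (is "arrows n ?H")
  unfolding arrows_def
proof (intro allI, rule ccontr)
  fix c
  assume "\<not> (\<exists>col. contains_in_color n c col ?H)"
  then have no_diamond: "\<not> (c {p, q} = col \<and> c {p, r} = col \<and> c {p, s} = col \<and>
      c {q, r} = col \<and> c {q, s} = col)"
    if "1 \<le> p" "p < q" "q < r" "r < s" "s \<le> n" for p q r s col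
    using contains_diamondI[of p q r s n c col] that by blast
  define N where "N col = {v \<in> {2..n}. c {1, v} = col}" for col
  have "N Red \<union> N Blue = {2..n}"
    unfolding N_def by (auto, metis color.exhaust)
  then have "n - 1 \<le> card (N Red) + card (N Blue)"
    using card_Un_le[of "N Red" "N Blue"] by simp
  \<comment> \<open>At least 11 vertices differ from 1. Six in one color suffice: two selections,
    each losing at most two, leave two.\<close>
  then have "6 \<le> card (N Red) \<or> 6 \<le> card (N Blue)"
    using assms by linarith
  then obtain col where card_N: "6 \<le> card (N col)" by blast
  \<comment> \<open>The opposite color: \<open>B\<close> and \<open>C\<close> are defined by
    \<open>\<noteq> col\<close>, whereas \<open>no_diamond\<close> needs an equation.\<close>
  obtain col' where col': "\<And>x. x \<noteq> col \<longleftrightarrow> x = col'"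
    by (cases col) (metis color.exhaust color.distinct(1))+
  define R where "R = N col"
  have "R \<noteq> {}"
    using card_N by (metis R_def card.empty not_numeral_le_zero)
  moreover have "R \<subseteq> {2..n}"
    by (auto simp: R_def N_def)
  ultimately have R: "finite R" "R \<noteq> {}" "R \<subseteq> {2..n}"
    by (auto intro: finite_subset)
  have one: "\<not> (c {x, y} = col \<and> c {x, z} = col)"
    if "x \<in> R" "y \<in> R" "z \<in> R" "x < y" "y < z" for x y z
    using that no_diamond[of 1 x y z col] by (auto simp: R_def N_def)
  define a where "a = Min R"
  have a: "a \<in> R" using R by (simp add: a_def)
  define B where "B = {y \<in> R. a < y \<and> c {a, y} \<noteq> col}"
  have "card R \<le> card B + 2"
    unfolding B_def a_def
  proof (rule card_larger_not_neighbours)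
    show "\<not> (c {Min R, y} = col \<and> c {Min R, z} = col)"
      if "y \<in> R" "z \<in> R" "Min R < y" "y < z" for y z
      using that one[of a y z] a unfolding a_def by blast
  qed (use R in auto)
  then have card_B: "4 \<le> card B" using card_N by (simp add: R_def)
  then have "B \<noteq> {}"
    by (metis card.empty not_numeral_le_zero)
  then have B: "finite B" "B \<noteq> {}" "B \<subseteq> R"
    using R by (auto simp: B_def)
  define b where "b = Min B"
  have b: "b \<in> B" using B by (simp add: b_def)
  define C where "C = {y \<in> B. b < y \<and> c {b, y} \<noteq> col}"
  have "card B \<le> card C + 2"
    unfolding C_def b_def
  proof (rule card_larger_not_neighbours)
    show "\<not> (c {Min B, y} = col \<and> c {Min B, z} = col)"
      if "y \<in> B" "z \<in> B" "Min B < y" "y < z" for y z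
      using that one[of b y z] b B(3) unfolding b_def by blast
  qed (use B in auto)
  then have "2 \<le> card C" using card_B by simp
  then obtain x y where xy: "x \<in> C" "y \<in> C" "x < y"
    by (rule card_ge_2_obtain_less)
  have "1 \<le> a" "a < b" "b < x" "y \<le> n"
    using a b xy R by (auto simp: B_def C_def)
  \<comment> \<open>Membership of \<open>b\<close>, \<open>x\<close>, \<open>y\<close> in
    \<open>B\<close> colors the edges at \<open>a\<close>, and membership of \<open>x\<close>,
    \<open>y\<close> in \<open>C\<close> those from \<open>b\<close>; the color of
    \<open>{x, y}\<close> is irrelevant.\<close>
  then show False
    using no_diamond[of a b x y col'] b xy by (simp add: B_def C_def col')
qed

theorem theorem3p10:
  shows "ordered_ramsey (vertex_ordering diamond_verts diamond_edges D2 2) \<le> 17"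
  unfolding ordered_ramsey_def by (rule Least_le, rule arrows_diamond) simp

end
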